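(* Let $n$ and $k$ be integers such that $n \geq 2$ and $1 < k < n$. Then $\mathcal{D}_k(K_n)$ is Eulerian if and only if $n$ is odd and $k=2$.
   Context: All graphs are finite and simple. $K_n$ is the complete graph on $n$ vertices. A dominating set of a graph $G$ is a set $D \subseteq V(G)$ such that every vertex of $V(G)\setminus D$ is adjacent to a vertex of $D$. The $k$-dominating graph $\mathcal{D}_k(G)$ is the graph whose vertices are the dominating sets of $G$ of cardinality at most $k$, two of them being adjacent if and only if one can be obtained from the other by adding or removing a single vertex of $G$. A graph is Eulerian if and only if every vertex has even degree and it contains at most one non-trivial component (a graph or component is trivial if it contains no edges). *)

theory Defs
  imports "Graph_Theory.Graph_Theory"
begin

text \<open>
  A finite simple graph is an instance of the locale \<^locale>\<open>graph\<close>: a finite symmetric digraph without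
  loops or parallel arcs, in which an undirected edge is a pair of opposite arcs. Hence the degree
  of a vertex is its \<^const>\<open>out_degree\<close> and the components are the strongly connected components,
  \<^const>\<open>pre_digraph.sccs\<close>. The library's \<^const>\<open>complete_digraph\<close> is the complete simple graph in this sense.
  The definitions below are meant for such graphs only; in particular \<^const>\<open>card\<close> is only ever
  applied to subsets of a finite vertex set.
\<close>

definition dominating_set :: "('a, 'b) pre_digraph \<Rightarrow> 'a set \<Rightarrow> bool" where
  "dominating_set G D \<longleftrightarrow>
     D \<subseteq> verts G \<and> (\<forall>v \<in> verts G - D. \<exists>d \<in> D. v \<rightarrow>\<^bsub>G\<^esub> d)"

definition dominating_graph :: "nat \<Rightarrow> ('a, 'b) pre_digraph \<Rightarrow> 'a set pair_pre_digraph" where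
  "dominating_graph k G =
     \<lparr> pverts = {D. dominating_set G D \<and> card D \<le> k},
       parcs = {(D, E). dominating_set G D \<and> card D \<le> k \<and> dominating_set G E \<and> card E \<le> k \<and>
         (\<exists>v \<in> verts G. (v \<notin> D \<and> E = insert v D) \<or> (v \<in> D \<and> E = D - {v}))} \<rparr>"

definition eulerian :: "('a, 'b) pre_digraph \<Rightarrow> bool" where
  "eulerian G \<longleftrightarrow>
     (\<forall>v \<in> verts G. even (out_degree G v)) \<and>
     (\<exists>\<^sub>\<le>\<^sub>1 C. C \<in> pre_digraph.sccs G \<and> arcs C \<noteq> {})"

lemma pair_graph_dominating_graph:
  assumes "graph G"
  shows "pair_graph (dominating_graph k G)"
proof -
  interpret graph G by fact
  have fin: "finite {D. dominating_set G D \<and> card D \<le> k}"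
    by (rule finite_subset[of _ "Pow (verts G)"]) (auto simp: dominating_set_def)
  show ?thesis
  proof unfold_locales
    show "finite (parcs (dominating_graph k G))"
      by (rule finite_subset[OF _ finite_cartesian_product[OF fin fin]])
         (auto simp: dominating_graph_def)
    show "symmetric (with_proj (dominating_graph k G))"
      unfolding symmetric_def sym_def by (auto simp: dominating_graph_def)
  qed (use fin in \<open>auto simp: dominating_graph_def\<close>)
qed

end

(* A set of vertices of the complete graph is dominating iff it is nonempty. Hence for k < n a
   dominating set D with 2 \<le> card D < k has degree n, a singleton has degree n - 1 (when k > 1),
   and a set of size k \<ge> 2 has degree k. Even degree of the singletons forces n odd, which rules out
   sets of size 2 < k. Conversely, for k \<ge> 2 the graph is connected: a set can be shrunk
   to a singleton, and {a} is joined to {b} through {a, b}. *)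
theory Submission
  imports Defs
begin

text \<open>A single element of \<open>D\<close> is adjacent to every vertex outside
  \<open>D\<close>. Positivity of \<open>n\<close> matters: in the graph without vertices the empty
  set dominates vacuously.\<close>

lemma dominating_set_complete_iff:
  assumes "complete_digraph n G" "n > 0"
  shows "dominating_set G D \<longleftrightarrow> D \<subseteq> verts G \<and> D \<noteq> {}"
proof -
  have "verts G \<noteq> {}"
    using assms by (auto simp: complete_digraph_def)
  moreover have "v \<rightarrow>\<^bsub>G\<^esub> d" if "v \<in> verts G - D" "d \<in> D" "D \<subseteq> verts G" for v d
    using assms that by (auto simp: complete_digraph_def)
  ultimately show ?thesis
    unfolding dominating_set_def by blast
qed

text \<open>The first summand counts removals, impossible from a singleton because the empty set
  does not dominate; the second counts additions, which the size bound blocks at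
  \<open>card D = k\<close>.\<close>

lemma out_degree_dominating_graph_complete:
  assumes G: "complete_digraph n G" and D: "D \<subseteq> verts G" "D \<noteq> {}" "card D \<le> k"
  shows "out_degree (with_proj (dominating_graph k G)) D =
           (if card D = 1 then 0 else card D) + (if card D < k then n - card D else 0)"
proof -
  interpret graph G using G by (simp add: complete_digraph_def)
  have n: "card (verts G) = n" using G by (simp add: complete_digraph_def)
  have fD: "finite D" using D finite_verts by (auto intro: finite_subset)
  then have "card D > 0" using D by (simp add: card_gt_0_iff)
  then have "n > 0" using card_mono[OF finite_verts D(1)] n by simp
  note dom = dominating_set_complete_iff[OF G \<open>n > 0\<close>]
  define R where "R = (\<lambda>v. (D, D - {v})) ` (if card D = 1 then {} else D)"
  define A where "A = (\<lambda>v. (D, insert v D)) ` (if card D < k then verts G - D else {})"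
  have arc: "(D, E) \<in> parcs (dominating_graph k G) \<longleftrightarrow> E \<noteq> {} \<and> card E \<le> k \<and>
      ((\<exists>v\<in>D. E = D - {v}) \<or> (\<exists>v\<in>verts G - D. E = insert v D))" for E
    using D by (auto simp: dominating_graph_def dom)
  \<comment> \<open>Whether the target is a vertex depends on \<open>card D\<close> alone, not on
    the removed or added \<open>v\<close>, so this condition can be pulled out of the existential
    over \<open>v\<close>.\<close>
  have removal: "E \<noteq> {} \<and> card E \<le> k \<longleftrightarrow> card D \<noteq> 1" if "v \<in> D" "E = D - {v}" for v E
    using that D(3) fD by (auto simp: card_1_singleton_iff card_Diff_singleton)
  have addition: "E \<noteq> {} \<and> card E \<le> k \<longleftrightarrow> card D < k"
    if "v \<in> verts G - D" "E = insert v D" for v E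
    using that fD by auto
  have arcs_eq: "(D, E) \<in> parcs (dominating_graph k G) \<longleftrightarrow> (D, E) \<in> R \<union> A" for E
  proof -
    have "(D, E) \<in> R \<longleftrightarrow> card D \<noteq> 1 \<and> (\<exists>v\<in>D. E = D - {v})"
      by (auto simp: R_def)
    also have "\<dots> \<longleftrightarrow> E \<noteq> {} \<and> card E \<le> k \<and> (\<exists>v\<in>D. E = D - {v})"
      using removal by metis
    finally have R: "(D, E) \<in> R \<longleftrightarrow> \<dots>" .
    have "(D, E) \<in> A \<longleftrightarrow> card D < k \<and> (\<exists>v\<in>verts G - D. E = insert v D)"
      by (auto simp: A_def)
    also have "\<dots> \<longleftrightarrow> E \<noteq> {} \<and> card E \<le> k \<and> (\<exists>v\<in>verts G - D. E = insert v D)"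
      using addition by metis
    finally show ?thesis
      unfolding arc Un_iff R by argo
  qed
  \<comment> \<open>\<open>arcs_eq\<close> speaks only of pairs that start at \<open>D\<close>; this
    extends it to arbitrary pairs.\<close>
  have tail: "fst e = D" if "e \<in> R \<union> A" for e
    using that by (auto simp: R_def A_def)
  have "out_arcs (with_proj (dominating_graph k G)) D = R \<union> A"
  proof (intro set_eqI)
    fix e show "e \<in> out_arcs (with_proj (dominating_graph k G)) D \<longleftrightarrow> e \<in> R \<union> A"
      using arcs_eq[of "snd e"] tail[of e] unfolding out_arcs_def by (cases e) auto
  qed
  moreover have "finite R" "finite A" "R \<inter> A = {}"
    using fD by (auto simp: R_def A_def)
  moreover have "card R = (if card D = 1 then 0 else card D)"
    unfolding R_def by (subst card_image) (auto simp: inj_on_def)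
  moreover have "card A = (if card D < k then n - card D else 0)"
    unfolding A_def using fD D n
    by (subst card_image) (auto simp: inj_on_def card_Diff_subset)
  ultimately show ?thesis
    by (simp add: out_degree_def card_Un_disjoint)
qed

text \<open>Makes the whole graph its only component, which settles the second Eulerian
  condition.\<close>

lemma strongly_connected_dominating_graph_complete:
  assumes G: "complete_digraph n G" and "n > 0" "k \<ge> 2"
  shows "strongly_connected (with_proj (dominating_graph k G))"
proof -
  interpret G: graph G using G by (simp add: complete_digraph_def)
  interpret H: graph "with_proj (dominating_graph k G)"
    by (intro pair_graph.pair_graphD_graph pair_graph_dominating_graph) unfold_locales
  let ?H = "with_proj (dominating_graph k G)"
  note dom = dominating_set_complete_iff[OF G \<open>n > 0\<close>]
  \<comment> \<open>\<open>{a, b}\<close> is a vertex because 2 \<le> \<open>k\<close>. For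
    \<open>a = b\<close> it collapses to \<open>{a}\<close> and gives no arc, so reflexivity takes
    over.\<close>
  have sing: "{a} \<rightarrow>\<^sup>*\<^bsub>?H\<^esub> {b}" if "a \<in> verts G" "b \<in> verts G" for a b
  proof (cases "a = b")
    case True
    then show ?thesis
      using that \<open>k \<ge> 2\<close> H.reachable_refl[of "{b}"] dom[of "{b}"]
      by (simp add: dominating_graph_def)
  next
    case False
    then have "{a} \<rightarrow>\<^bsub>?H\<^esub> {a, b}" "{a, b} \<rightarrow>\<^bsub>?H\<^esub> {b}"
      using that \<open>k \<ge> 2\<close> by (auto simp: dominating_graph_def dom)
    then show ?thesis
      by (blast intro: H.reachable_trans H.reachable_adjI)
  qed
  have shrink: "D \<rightarrow>\<^sup>*\<^bsub>?H\<^esub> {a}"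
    if "finite D" "D \<noteq> {}" "D \<subseteq> verts G" "card D \<le> k" "a \<in> verts G" for D a
    using that
  \<comment> \<open>The induction decides which singleton \<open>{x}\<close> is left at the end, so
    \<open>sing\<close> is needed to move on to \<open>{a}\<close>; \<open>a\<close> need not lie in
    \<open>D\<close>.\<close>
  proof (induction D rule: finite_ne_induct)
    case (singleton x)
    then show ?case using sing by simp
  next
    case (insert x F)
    then have "insert x F \<rightarrow>\<^bsub>?H\<^esub> F"
      by (auto simp: dominating_graph_def dom)
    moreover have "F \<rightarrow>\<^sup>*\<^bsub>?H\<^esub> {a}"
      using insert by auto
    ultimately show ?case
      by (rule H.adj_reachable_trans)
  qed
  obtain a where a: "a \<in> verts G"
    using G \<open>n > 0\<close> by (fastforce simp: complete_digraph_def)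
  have reach: "D \<rightarrow>\<^sup>*\<^bsub>?H\<^esub> {a}" if "D \<in> verts ?H" for D
    using that a by (intro shrink) (auto simp: dominating_graph_def dom intro: finite_subset)
  have "{a} \<in> verts ?H"
    using a \<open>k \<ge> 2\<close> by (simp add: dominating_graph_def dom)
  \<comment> \<open>Arcs come in opposite pairs, so a walk to the hub \<open>{a}\<close> can be
    reversed, and any two vertices are joined through the hub.\<close>
  then show ?thesis
    unfolding strongly_connected_def
    using reach H.symmetric_reachable' H.reachable_trans by blast
qed

theorem mainTheorem5:
  fixes G :: "('a, 'b) pre_digraph" and n k :: nat
  assumes "n \<ge> 2" and "1 < k" and "k < n"
    and "complete_digraph n G"
  shows "eulerian (with_proj (dominating_graph k G)) \<longleftrightarrow> odd n \<and> k = 2"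
proof -
  let ?H = "with_proj (dominating_graph k G)"
  interpret G: graph G using assms(4) by (simp add: complete_digraph_def)
  interpret H: graph "with_proj (dominating_graph k G)"
    by (intro pair_graph.pair_graphD_graph pair_graph_dominating_graph) unfold_locales
  have n: "card (verts G) = n" "n > 0"
    using assms by (auto simp: complete_digraph_def)
  have verts: "D \<in> pverts (dominating_graph k G) \<longleftrightarrow> D \<subseteq> verts G \<and> D \<noteq> {} \<and> card D \<le> k" for D
    using dominating_set_complete_iff[OF assms(4) n(2)] by (auto simp: dominating_graph_def)
  note degree = out_degree_dominating_graph_complete[OF assms(4)]
  \<comment> \<open>Supplies the test sets of sizes 1 and 2 for the forward direction;
    \<open>k < n\<close> leaves enough vertices.\<close>
  have ex: "\<exists>D. D \<in> verts ?H \<and> card D = j" if j: "0 < j" "j \<le> k" for j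
  proof -
    obtain D where "D \<subseteq> verts G" "card D = j"
      using obtain_subset_with_card_n[of j "verts G"] j assms n by auto
    with j have "D \<in> verts ?H"
      by (auto simp: verts)
    with \<open>card D = j\<close> show ?thesis by blast
  qed
  show ?thesis
  proof
    assume "eulerian ?H"
    then have ev: "even (out_degree ?H D)" if "D \<in> verts ?H" for D
      using that by (simp add: eulerian_def)
    obtain D1 where D1: "D1 \<in> verts ?H" "card D1 = 1"
      using ex[of 1] assms by auto
    then have "out_degree ?H D1 = n - 1"
      using degree[of D1 k] assms by (simp add: verts)
    then have "odd n"
      using ev[OF D1(1)] n by simp
    moreover have "k = 2"
    proof (rule ccontr)
      assume "k \<noteq> 2"
      with assms have "k > 2" by simp
      \<comment> \<open>Strictly below the bound both moves count: 2 removals and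
        \<open>n - 2\<close> additions.\<close>
      obtain D2 where D2: "D2 \<in> verts ?H" "card D2 = 2"
        using ex[of 2] assms by auto
      then have "out_degree ?H D2 = n"
        using degree[of D2 k] assms \<open>k > 2\<close> by (simp add: verts)
      then show False
        using ev[OF D2(1)] \<open>odd n\<close> by simp
    qed
    ultimately show "odd n \<and> k = 2" ..
  next
    assume R: "odd n \<and> k = 2"
    have "even (out_degree ?H D)" if D: "D \<in> verts ?H" for D
    proof -
      have sub: "D \<subseteq> verts G" and ne: "D \<noteq> {}" and le: "card D \<le> k"
        using D by (simp_all add: verts)
      moreover have "0 < card D"
        using ne finite_subset[OF sub G.finite_verts] by (simp add: card_gt_0_iff)
      ultimately have "card D = 1 \<or> card D = 2"
        using R by linarith
      \<comment> \<open>With \<open>k = 2\<close> a pair admits no additions and has degree 2; a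
        singleton has the even degree \<open>n - 1\<close>.\<close>
      then show ?thesis
        using degree[OF sub ne le] R by auto
    qed
    moreover have "pre_digraph.sccs ?H = {?H}"
      using strongly_connected_dominating_graph_complete[OF assms(4) n(2)] assms(2)
        H.strongly_connected_eq_iff by auto
    ultimately show "eulerian ?H"
      by (auto simp: eulerian_def Uniq_def)
  qed
qed

end
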